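(* Let $H\subseteq\mathbb{R}^2$ be the set (the Knaster continuum) constructed as follows. For $\alpha\in 2^{\mathbb{N}}$ write $\boldsymbol{\alpha}=\sum_{i=0}^\infty \frac{2\alpha_i}{3^{i+1}}\in[0,1]$, and let $\overline{\alpha}\in 2^{\mathbb{N}}$ be given by $\overline{\alpha}_i=1-\alpha_i$. Let $N_0=2^{\mathbb{N}}$ and, for $k\ge 1$, $N_k=\{\alpha\in 2^{\mathbb{N}}:\min\{i:\alpha_i=1\}=k-1\}$. For $k\ge1$ and $\alpha\in N_k$, let $\widehat{\alpha}\in N_k$ be defined by $\widehat{\alpha}_i=\alpha_i$ for $i\le k-1$ (so $\widehat{\alpha}_i=0$ for $i<k-1$ and $\widehat{\alpha}_{k-1}=1$) and $\widehat{\alpha}_i=1-\alpha_i$ for $i\ge k$. Let $x_0=\frac12$, and for $k\ge1$ let $x_k=\frac{\boldsymbol{\alpha}+\widehat{\boldsymbol{\alpha}}}{2}$ for any $\alpha\in N_k$ (this number does not depend on the choice of $\alpha\in N_k$), where $\widehat{\boldsymbol{\alpha}}$ denotes the real number associated to $\widehat{\alpha}$. Let $H_0$ be the union over $\alpha\in N_0$ of the closed upper semicircles (in $\{y\ge0\}$) centered at $(x_0,0)$ of radius $|x_0-\boldsymbol{\alpha}|$, joining $(\boldsymbol{\alpha},0)$ and $(\overline{\boldsymbol{\alpha}},0)$; for $k\ge1$ let $H_k$ be the union over $\alpha\in N_k$ of the closed lower semicircles (in $\{y\le 0\}$) centered at $(x_k,0)$ of radius $|x_k-\boldsymbol{\alpha}|$,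 joining $(\boldsymbol{\alpha},0)$ and $(\widehat{\boldsymbol{\alpha}},0)$; and let $H=\bigcup_{k\in\mathbb{N}}H_k$. Then the path-connectedness equivalence relation $\approx_H$ on $H$ is Borel bireducible to the equivalence relation $E_0^*$ on $2^{\mathbb{N}}$.
   Context: $2^{\mathbb{N}}$ is the Cantor space with the product topology, and $\mathbb{N}=\{0,1,2,\dots\}$. The equivalence relation $E_0$ on $2^{\mathbb{N}}$ is given by $\alpha E_0\beta$ iff there is $m$ with $\alpha_n=\beta_n$ for all $n\ge m$. The equivalence relation $E_0^*$ on $2^{\mathbb{N}}$ is given by $\alpha E_0^*\beta$ iff $\alpha E_0\beta$ or $\alpha E_0\overline{\beta}$, where $\overline{\beta}_n=1-\beta_n$. For a Polish space $X$ (here $H$ with the subspace topology from $\mathbb{R}^2$), $x\approx_X y$ iff there is a continuous $\gamma:[0,1]\to X$ with $\gamma(0)=x$, $\gamma(1)=y$. For equivalence relations $E$ on $X$ and $F$ on $Y$ (Polish spaces), $E\le_B F$ means there is a Borel map $f:X\to Y$ with $xEy\iff f(x)Ff(y)$; Borel bireducible means $E\le_B F$ and $F\le_B E$. *)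

theory Defs
  imports "HOL-Analysis.Analysis"
begin

text \<open>
  Points of the Cantor space are functions of type \<^typ>\<open>nat \<Rightarrow> bool\<close>, where \<^const>\<open>True\<close> stands for
  the digit 1. The topology of this type is the product of the discrete topologies.
\<close>

type_synonym cantor = "nat \<Rightarrow> bool"

definition compl_seq :: "cantor \<Rightarrow> cantor" where
  "compl_seq \<alpha> = (\<lambda>n. \<not> \<alpha> n)"

definition E0 :: "cantor \<Rightarrow> cantor \<Rightarrow> bool" where
  "E0 \<alpha> \<beta> \<longleftrightarrow> (\<exists>m. \<forall>n\<ge>m. \<alpha> n = \<beta> n)"

definition E0_star :: "cantor \<Rightarrow> cantor \<Rightarrow> bool" where
  "E0_star \<alpha> \<beta> \<longleftrightarrow> E0 \<alpha> \<beta> \<or> E0 \<alpha> (compl_seq \<beta>)"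

text \<open>
  A space is given as a subset of a topological type, with the subspace topology; the Borel sets of
  the subspace are the traces of the ambient Borel sets. Measurability includes that the map sends
  \<open>X\<close> into \<open>Y\<close>.
\<close>

definition borel_reducible ::
  "'a::topological_space set \<Rightarrow> ('a \<Rightarrow> 'a \<Rightarrow> bool) \<Rightarrow>
   'b::topological_space set \<Rightarrow> ('b \<Rightarrow> 'b \<Rightarrow> bool) \<Rightarrow> bool" where
  "borel_reducible X E Y F \<longleftrightarrow>
     (\<exists>f \<in> restrict_space borel X \<rightarrow>\<^sub>M restrict_space borel Y.
        \<forall>x\<in>X. \<forall>y\<in>X. E x y \<longleftrightarrow> F (f x) (f y))"

definition borel_bireducible ::
  "'a::topological_space set \<Rightarrow> ('a \<Rightarrow> 'a \<Rightarrow> bool) \<Rightarrow>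
   'b::topological_space set \<Rightarrow> ('b \<Rightarrow> 'b \<Rightarrow> bool) \<Rightarrow> bool" where
  "borel_bireducible X E Y F \<longleftrightarrow> borel_reducible X E Y F \<and> borel_reducible Y F X E"

definition cantor_real :: "cantor \<Rightarrow> real" where
  "cantor_real \<alpha> = (\<Sum>i. 2 * of_bool (\<alpha> i) / 3 ^ (i + 1))"

definition N :: "nat \<Rightarrow> cantor set" where
  "N k = (if k = 0 then UNIV else {\<alpha>. (\<exists>i. \<alpha> i) \<and> (LEAST i. \<alpha> i) = k - 1})"

definition hat :: "nat \<Rightarrow> cantor \<Rightarrow> cantor" where
  "hat k \<alpha> = (\<lambda>i. if i < k then \<alpha> i else \<not> \<alpha> i)"

text \<open>The description below is justified by \<open>centre_eq\<close>.\<close>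

definition centre :: "nat \<Rightarrow> real" where
  "centre k = (if k = 0 then 1/2
     else (THE x. \<forall>\<alpha>\<in>N k. x = (cantor_real \<alpha> + cantor_real (hat k \<alpha>)) / 2))"

definition upper_semicircle :: "real \<Rightarrow> real \<Rightarrow> (real \<times> real) set" where
  "upper_semicircle c r = {p \<in> sphere (c, 0) r. snd p \<ge> 0}"

definition lower_semicircle :: "real \<Rightarrow> real \<Rightarrow> (real \<times> real) set" where
  "lower_semicircle c r = {p \<in> sphere (c, 0) r. snd p \<le> 0}"

definition H_part :: "nat \<Rightarrow> (real \<times> real) set" where
  "H_part k =
     (if k = 0 then \<Union>\<alpha>\<in>N 0. upper_semicircle (centre 0) \<bar>centre 0 - cantor_real \<alpha>\<bar>
      else \<Union>\<alpha>\<in>N k. lower_semicircle (centre k) \<bar>centre k - cantor_real \<alpha>\<bar>)"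

definition knaster :: "(real \<times> real) set" where
  "knaster = (\<Union>k. H_part k)"

lemma summable_cantor_real: "summable (\<lambda>i. 2 * of_bool (\<alpha> i) / 3 ^ (i + 1) :: real)"
proof (rule summable_comparison_test)
  show "summable (\<lambda>i. (1/3::real) ^ i)" by (rule summable_geometric) simp
  show "\<exists>M. \<forall>i\<ge>M. norm (2 * of_bool (\<alpha> i) / 3 ^ (i + 1) :: real) \<le> (1/3) ^ i"
    by (intro exI[of _ 0] allI impI) (auto simp: of_bool_def power_divide divide_simps)
qed

lemma N_D:
  assumes "\<alpha> \<in> N k" "k \<ge> 1"
  shows "\<alpha> (k - 1)" "i < k - 1 \<Longrightarrow> \<not> \<alpha> i"
proof -
  have ex: "\<exists>i. \<alpha> i" and L: "(LEAST i. \<alpha> i) = k - 1"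
    using assms by (auto simp: N_def)
  show "\<alpha> (k - 1)" using LeastI_ex[OF ex] L by simp
  show "i < k - 1 \<Longrightarrow> \<not> \<alpha> i" using not_less_Least[of i \<alpha>] L by simp
qed

lemma centre_unique:
  assumes "\<alpha> \<in> N k" "\<beta> \<in> N k" "k \<ge> 1"
  shows "cantor_real \<alpha> + cantor_real (hat k \<alpha>) = cantor_real \<beta> + cantor_real (hat k \<beta>)"
proof -
  have agree: "\<alpha> i = \<beta> i" if "i < k" for i
  proof (cases "i = k - 1")
    case True
    then show ?thesis using N_D(1)[OF assms(1,3)] N_D(1)[OF assms(2,3)] by simp
  next
    case False
    then have "i < k - 1" using that by simp
    then show ?thesis using N_D(2)[OF assms(1,3)] N_D(2)[OF assms(2,3)] by simp
  qed
  have "(2 * of_bool (\<alpha> i) / 3 ^ (i + 1) + 2 * of_bool (hat k \<alpha> i) / 3 ^ (i + 1) :: real) =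
        2 * of_bool (\<beta> i) / 3 ^ (i + 1) + 2 * of_bool (hat k \<beta> i) / 3 ^ (i + 1)" for i
    using agree[of i] by (cases "i < k") (auto simp: hat_def)
  then show ?thesis
    unfolding cantor_real_def
    by (simp only: suminf_add[OF summable_cantor_real summable_cantor_real])
qed

lemma centre_eq:
  assumes "\<alpha> \<in> N k" "k \<ge> 1"
  shows "centre k = (cantor_real \<alpha> + cantor_real (hat k \<alpha>)) / 2"
proof -
  have "(THE x. \<forall>\<alpha>\<in>N k. x = (cantor_real \<alpha> + cantor_real (hat k \<alpha>)) / 2) =
        (cantor_real \<alpha> + cantor_real (hat k \<alpha>)) / 2"
  proof (rule the_equality)
    show "\<forall>\<beta>\<in>N k. (cantor_real \<alpha> + cantor_real (hat k \<alpha>)) / 2 =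
            (cantor_real \<beta> + cantor_real (hat k \<beta>)) / 2"
      using centre_unique[OF assms(1) _ assms(2)] by auto
  qed (use assms in blast)
  then show ?thesis using assms(2) by (simp add: centre_def)
qed

end

theory Submission
  imports Defs
begin

text \<open>
  Follow an arc of \<open>H\<close> through the Cantor set on the axis: an upper arc complements the digits, and a
  lower arc followed by an upper one replaces a prefix \<open>0\<dots>01\<close> by \<open>1\<dots>10\<close>, which is a step of the
  odometer. Hence the points of one arc component on the axis form exactly one class of \<open>E\<^sub>0\<^sup>*\<close>.

  That no path leaves its arc is seen from continuous maps into the Cantor space, which is totally
  disconnected. Where \<open>y > 0\<close>, the radius of the upper semicircle is such a map. Where \<open>x \<noteq> 1/2\<close>,
  slide a point with \<open>y \<ge> 0\<close> down to the axis along its semicircle, on its side of \<open>x = 1/2\<close>, and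
  then take the left end of the lower semicircle; this remains continuous at the end point \<open>(0, 0)\<close>,
  where the lower semicircles accumulate. These two open sets cover \<open>H\<close>, so the class of
  \<open>E\<^sub>0\<^sup>*\<close> is locally constant along paths.
\<close>

section \<open>The relation \<open>E\<^sub>0\<^sup>*\<close>\<close>

lemma E0_refl: "E0 \<alpha> \<alpha>"
  by (simp add: E0_def)

lemma E0_sym: "E0 \<alpha> \<beta> \<Longrightarrow> E0 \<beta> \<alpha>"
  by (auto simp: E0_def)

lemma E0_trans: "E0 \<alpha> \<beta> \<Longrightarrow> E0 \<beta> \<gamma> \<Longrightarrow> E0 \<alpha> \<gamma>"
  unfolding E0_def
proof (elim exE)
  fix m n assume "\<forall>i\<ge>m. \<alpha> i = \<beta> i" "\<forall>i\<ge>n. \<beta> i = \<gamma> i"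
  then show "\<exists>m. \<forall>i\<ge>m. \<alpha> i = \<gamma> i"
    by (intro exI[of _ "max m n"]) simp
qed

lemma E0_compl_iff: "E0 (compl_seq \<alpha>) (compl_seq \<beta>) \<longleftrightarrow> E0 \<alpha> \<beta>"
  by (simp add: E0_def compl_seq_def)

lemma compl_seq_compl_seq [simp]: "compl_seq (compl_seq \<alpha>) = \<alpha>"
  by (simp add: compl_seq_def)

lemma E0_star_refl: "E0_star \<alpha> \<alpha>"
  by (simp add: E0_star_def E0_refl)

lemma E0_star_sym: "E0_star \<alpha> \<beta> \<Longrightarrow> E0_star \<beta> \<alpha>"
  unfolding E0_star_def by (metis E0_compl_iff E0_sym compl_seq_compl_seq)

lemma E0_star_trans: "E0_star \<alpha> \<beta> \<Longrightarrow> E0_star \<beta> \<gamma> \<Longrightarrow> E0_star \<alpha> \<gamma>"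
  unfolding E0_star_def by (metis E0_compl_iff E0_trans compl_seq_compl_seq)

lemma E0_star_compl_seq: "E0_star \<alpha> (compl_seq \<alpha>)"
  by (simp add: E0_star_def E0_refl)

text \<open>From digit \<open>k\<close> on, \<open>hat k \<alpha>\<close> agrees with the complement
  of \<open>\<alpha>\<close>.\<close>

lemma E0_star_hat: "E0_star \<alpha> (hat k \<alpha>)"
  by (auto simp: E0_star_def E0_def compl_seq_def hat_def intro!: exI[of _ k])

lemma N_iff:
  assumes "k \<ge> 1"
  shows "\<alpha> \<in> N k \<longleftrightarrow> \<alpha> (k - 1) \<and> (\<forall>i<k - 1. \<not> \<alpha> i)"
proof
  assume R: "\<alpha> (k - 1) \<and> (\<forall>i<k - 1. \<not> \<alpha> i)"
  then have "(LEAST i. \<alpha> i) = k - 1"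
    by (intro Least_equality) (auto simp: not_less[symmetric])
  with R assms show "\<alpha> \<in> N k" by (auto simp: N_def)
qed (use N_D assms in blast)

lemma hat_in_N: "k \<ge> 1 \<Longrightarrow> \<alpha> \<in> N k \<Longrightarrow> hat k \<alpha> \<in> N k"
  by (auto simp: N_iff hat_def)

text \<open>The zero sequence is exceptional throughout: it gives the end point
  \<open>(0, 0)\<close>, the only axis point of the continuum on no lower semicircle.\<close>

lemma N_cases:
  obtains "\<alpha> = (\<lambda>_. False)" | k where "k \<ge> 1" "\<alpha> \<in> N k"
proof (cases "\<exists>i. \<alpha> i")
  case True
  then have "\<alpha> \<in> N (Suc (LEAST i. \<alpha> i))"
    by (simp add: N_def)
  then show ?thesis using that(2) by force
qed (use that(1) in auto)

text \<open>Induction on a bound \<open>n\<close> from which on the sequences agree; a single digit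
  is changed by combining \<open>hat\<close> with \<open>compl_seq\<close>. The lemma is meant for
  \<open>R\<close> saying that two axis points are joined by a path, where these two moves are
  single arcs.\<close>

lemma E0_star_least:
  assumes refl: "\<And>\<alpha>. R \<alpha> \<alpha>"
    and sym: "\<And>\<alpha> \<beta>. R \<alpha> \<beta> \<Longrightarrow> R \<beta> \<alpha>"
    and trans: "\<And>\<alpha> \<beta> \<gamma>. R \<alpha> \<beta> \<Longrightarrow> R \<beta> \<gamma> \<Longrightarrow> R \<alpha> \<gamma>"
    and compl: "\<And>\<alpha>. R \<alpha> (compl_seq \<alpha>)"
    and hat: "\<And>k \<alpha>. k \<ge> 1 \<Longrightarrow> \<alpha> \<in> N k \<Longrightarrow> R \<alpha> (hat k \<alpha>)"
    and "E0_star \<alpha> \<beta>"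
  shows "R \<alpha> \<beta>"
proof -
  have E0: "R \<alpha> \<beta>" if "\<forall>i\<ge>n. \<alpha> i = \<beta> i" for n \<alpha> \<beta>
    using that
  proof (induction n arbitrary: \<alpha> \<beta>)
    case 0
    then have "\<alpha> = \<beta>" by auto
    then show ?case by (simp add: refl)
  next
    case (Suc n)
    have step: "R \<alpha> \<beta>" if eq: "\<forall>i\<ge>Suc n. \<alpha> i = \<beta> i" and "\<alpha> n" "\<not> \<beta> n" for \<alpha> \<beta>
    proof -
      \<comment> \<open>Clearing the digits below \<open>n\<close> costs one use of the induction
        hypothesis and puts the sequence into \<open>N (Suc n)\<close>, where \<open>hat\<close> is
        available.\<close>
      define \<delta> where "\<delta> = (\<lambda>i. if i < n then False else \<alpha> i)"
      have "R \<alpha> \<delta>" by (rule Suc.IH) (simp add: \<delta>_def)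
      moreover have "R \<delta> (hat (Suc n) \<delta>)"
        using \<open>\<alpha> n\<close> by (intro hat) (auto simp: N_iff \<delta>_def)
      \<comment> \<open>Together the two moves flip exactly the digits up to \<open>n\<close>: digit
        \<open>n\<close> becomes 0, the tail is restored, and what still differs from
        \<open>\<beta>\<close> lies below \<open>n\<close>.\<close>
      moreover have "R (hat (Suc n) \<delta>) (compl_seq (hat (Suc n) \<delta>))" by (rule compl)
      moreover have "R (compl_seq (hat (Suc n) \<delta>)) \<beta>"
      proof (rule Suc.IH, intro allI impI)
        fix i assume "n \<le> i"
        then show "compl_seq (hat (Suc n) \<delta>) i = \<beta> i"
          using eq \<open>\<alpha> n\<close> \<open>\<not> \<beta> n\<close>
          by (cases "i = n") (auto simp: compl_seq_def hat_def \<delta>_def)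
      qed
      ultimately show ?thesis using trans by blast
    qed
    show ?case
    proof (cases "\<alpha> n = \<beta> n")
      case True
      then show ?thesis using Suc.IH Suc.prems by (metis le_antisym not_less_eq_eq)
    next
      case False
      then show ?thesis using step[of \<alpha> \<beta>] step[of \<beta> \<alpha>] Suc.prems sym by metis
    qed
  qed
  from \<open>E0_star \<alpha> \<beta>\<close> consider "R \<alpha> \<beta>" | "R \<alpha> (compl_seq \<beta>)"
    unfolding E0_star_def E0_def using E0 by blast
  then show ?thesis
  proof cases
    case 2
    then show ?thesis by (rule trans[OF _ sym[OF compl]])
  qed
qed

section \<open>The embedding of the Cantor space into the line\<close>

lemma sums_two_thirds: "(\<lambda>i. 2 / 3 ^ (i + 1) :: real) sums 1"
proof -
  have "(\<lambda>i. (2/3) * (1/3) ^ i :: real) sums ((2/3) * (1 / (1 - 1/3)))"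
    by (intro sums_mult geometric_sums) simp
  then show ?thesis by (simp add: power_divide field_simps)
qed

lemma cantor_real_nonneg: "0 \<le> cantor_real \<alpha>"
  unfolding cantor_real_def by (intro suminf_nonneg summable_cantor_real) auto

lemma cantor_real_compl: "cantor_real (compl_seq \<alpha>) = 1 - cantor_real \<alpha>"
proof -
  have "cantor_real \<alpha> + cantor_real (compl_seq \<alpha>) =
      (\<Sum>i. 2 * of_bool (\<alpha> i) / 3 ^ (i + 1) + 2 * of_bool (compl_seq \<alpha> i) / 3 ^ (i + 1))"
    unfolding cantor_real_def by (rule suminf_add[OF summable_cantor_real summable_cantor_real])
  also have "\<dots> = (\<Sum>i. 2 / 3 ^ (i + 1))"
    by (intro suminf_cong) (simp add: compl_seq_def of_bool_def)
  also have "\<dots> = 1" using sums_two_thirds by (rule sums_unique[symmetric])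
  finally show ?thesis by simp
qed

lemma cantor_real_le_1: "cantor_real \<alpha> \<le> 1"
  using cantor_real_nonneg[of "compl_seq \<alpha>"] by (simp add: cantor_real_compl)

lemma cantor_real_split:
  "cantor_real \<alpha> =
     (\<Sum>i<n. 2 * of_bool (\<alpha> i) / 3 ^ (i + 1)) + cantor_real (\<lambda>i. \<alpha> (i + n)) / 3 ^ n"
proof -
  have "cantor_real \<alpha> = (\<Sum>i<n. 2 * of_bool (\<alpha> i) / 3 ^ (i + 1)) +
      (\<Sum>i. 2 * of_bool (\<alpha> (i + n)) / 3 ^ (i + n + 1))"
    unfolding cantor_real_def
    using suminf_split_initial_segment[OF summable_cantor_real, of \<alpha> n] by simp
  also have "(\<Sum>i. 2 * of_bool (\<alpha> (i + n)) / 3 ^ (i + n + 1)) =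
      (\<Sum>i. (2 * of_bool (\<alpha> (i + n)) / 3 ^ (i + 1)) / 3 ^ n :: real)"
    by (simp add: power_add mult_ac)
  also have "\<dots> = cantor_real (\<lambda>i. \<alpha> (i + n)) / 3 ^ n"
    unfolding cantor_real_def by (rule suminf_divide[OF summable_cantor_real])
  finally show ?thesis .
qed

text \<open>Digit \<open>n\<close> is worth \<open>2 / 3 ^ Suc n\<close>, while all later digits
  together contribute at most half of that.\<close>

lemma cantor_real_less:
  assumes "\<And>i. i < n \<Longrightarrow> \<alpha> i = \<beta> i" "\<not> \<alpha> n" "\<beta> n"
  shows "cantor_real \<alpha> < cantor_real \<beta>"
proof -
  have "(\<Sum>i<n. 2 * of_bool (\<alpha> i) / 3 ^ (i + 1) :: real) =
      (\<Sum>i<n. 2 * of_bool (\<beta> i) / 3 ^ (i + 1))"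
    using assms(1) by (intro sum.cong) auto
  moreover have "cantor_real (\<lambda>i. \<alpha> (i + Suc n)) / 3 ^ Suc n \<le> 1 / 3 ^ Suc n"
    by (intro divide_right_mono cantor_real_le_1) simp
  moreover have "0 \<le> cantor_real (\<lambda>i. \<beta> (i + Suc n)) / 3 ^ Suc n"
    by (intro divide_nonneg_nonneg cantor_real_nonneg) simp
  moreover have "(1::real) / 3 ^ Suc n < 2 / 3 ^ Suc n"
    by (intro divide_strict_right_mono) auto
  ultimately show ?thesis
    using assms(2,3) cantor_real_split[of \<alpha> "Suc n"] cantor_real_split[of \<beta> "Suc n"] by simp
qed

lemma inj_cantor_real: "inj cantor_real"
proof (rule injI, rule ccontr)
  fix \<alpha> \<beta> assume eq: "cantor_real \<alpha> = cantor_real \<beta>" and "\<alpha> \<noteq> \<beta>"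
  then have ex: "\<exists>i. \<alpha> i \<noteq> \<beta> i" by auto
  define n where "n = (LEAST i. \<alpha> i \<noteq> \<beta> i)"
  have "\<alpha> n \<noteq> \<beta> n" unfolding n_def by (rule LeastI_ex[OF ex])
  moreover have "\<alpha> i = \<beta> i" if "i < n" for i
    using that not_less_Least unfolding n_def by blast
  ultimately show False
    using cantor_real_less[of n \<alpha> \<beta>] cantor_real_less[of n \<beta> \<alpha>] eq by force
qed

lemma continuous_on_cantor_real: "continuous_on UNIV cantor_real"
proof -
  have lim: "uniform_limit UNIV (\<lambda>n \<alpha>. \<Sum>i<n. 2 * of_bool (\<alpha> i) / 3 ^ (i + 1))
      (\<lambda>\<alpha>. \<Sum>i. 2 * of_bool (\<alpha> i) / 3 ^ (i + 1) :: real) sequentially"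
  proof (rule Weierstrass_m_test)
    show "summable (\<lambda>i. 2 / 3 ^ (i + 1) :: real)"
      using sums_two_thirds by (rule sums_summable)
    show "norm (2 * of_bool (\<alpha> n) / 3 ^ (n + 1) :: real) \<le> 2 / 3 ^ (n + 1)" for n and \<alpha> :: cantor
      by simp
  qed
  have "continuous_on UNIV (\<lambda>\<alpha>. of_bool (\<alpha> i) :: real)" for i :: nat
    by (rule continuous_on_compose2[of UNIV of_bool UNIV "\<lambda>\<alpha>. \<alpha> i"])
      (auto simp: continuous_on_open_vimage open_discrete)
  then have cont: "\<forall>\<^sub>F n in sequentially. continuous_on UNIV
      (\<lambda>\<alpha>. \<Sum>i<n. 2 * of_bool (\<alpha> i) / 3 ^ (i + 1) :: real)"
    by (intro always_eventually allI continuous_intros) auto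
  show ?thesis
    unfolding cantor_real_def by (rule uniform_limit_theorem[OF cont lim]) simp
qed

section \<open>Reading off the digits continuously\<close>

lemma compact_UNIV_cantor: "compact (UNIV :: cantor set)"
proof -
  have "compact_space (euclidean :: bool topology)"
    by (simp add: compact_space_def finite_imp_compact)
  then have "compact_space (product_topology (\<lambda>_::nat. euclidean :: bool topology) UNIV)"
    by (simp add: compact_space_product_topology)
  then show ?thesis
    by (simp add: euclidean_product_topology compact_space_def)
qed

text \<open>Outside \<open>range cantor_real\<close> the value is arbitrary, so each later use for
  continuity first places the argument in that range.\<close>

definition cantor_digits :: "real \<Rightarrow> cantor" where
  "cantor_digits = inv cantor_real"

lemma cantor_digits_cantor_real [simp]: "cantor_digits (cantor_real \<alpha>) = \<alpha>"
  by (simp add: cantor_digits_def inj_cantor_real)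

text \<open>A continuous injection of a compact space into a Hausdorff space has a continuous
  inverse on its image.\<close>

lemma continuous_on_cantor_digits: "continuous_on (range cantor_real) cantor_digits"
  by (rule continuous_on_inv[OF continuous_on_cantor_real compact_UNIV_cantor]) simp

text \<open>Each digit of \<open>g\<close> is a continuous map into a discrete space, hence constant
  on a connected set.\<close>

lemma connected_imp_constant_cantor:
  fixes g :: "'a::topological_space \<Rightarrow> cantor"
  assumes "connected S" "continuous_on S g" "x \<in> S" "y \<in> S"
  shows "g x = g y"
proof
  fix n
  have "continuous_on S (\<lambda>x. g x n)"
    using assms(2) by (rule continuous_on_product_then_coordinatewise)
  then show "g x n = g y n"
    using assms(1,3,4) unfolding connected_iff_const by metis
qed

section \<open>The lower semicircles\<close>

text \<open>The prefix \<open>0...01\<close> of length \<open>k\<close> contributes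
  \<open>2 / 3 ^ k\<close>; the remaining digits form a Cantor number scaled by
  \<open>1 / 3 ^ k\<close>.\<close>

lemma cantor_real_N:
  assumes "k \<ge> 1" "\<alpha> \<in> N k"
  shows "cantor_real \<alpha> = (2 + cantor_real (\<lambda>i. \<alpha> (i + k))) / 3 ^ k"
proof -
  obtain n where n: "k = Suc n" using assms(1) by (cases k) auto
  have "(\<Sum>i<n. 2 * of_bool (\<alpha> i) / 3 ^ (i + 1) :: real) = 0"
    using assms by (intro sum.neutral) (auto simp: N_iff n)
  then have "(\<Sum>i<k. 2 * of_bool (\<alpha> i) / 3 ^ (i + 1) :: real) = 2 / 3 ^ k"
    using assms by (simp add: n N_iff)
  then show ?thesis using cantor_real_split[of \<alpha> k] by (simp add: add_divide_distrib)
qed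

lemma cantor_real_N_bounds:
  assumes "k \<ge> 1" "\<alpha> \<in> N k"
  shows "2 / 3 ^ k \<le> cantor_real \<alpha>" "cantor_real \<alpha> \<le> 3 / 3 ^ k"
  using cantor_real_nonneg[of "\<lambda>i. \<alpha> (i + k)"] cantor_real_le_1[of "\<lambda>i. \<alpha> (i + k)"]
  by (simp_all add: cantor_real_N[OF assms] divide_right_mono)

text \<open>The tails after position \<open>k\<close> are complementary, so their values add up to
  1; with the two equal prefixes this gives \<open>2 + 2 + 1 = 5\<close>.\<close>

lemma cantor_real_hat:
  assumes "k \<ge> 1" "\<alpha> \<in> N k"
  shows "cantor_real (hat k \<alpha>) = 5 / 3 ^ k - cantor_real \<alpha>"
proof -
  have "(\<lambda>i. hat k \<alpha> (i + k)) = compl_seq (\<lambda>i. \<alpha> (i + k))"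
    by (auto simp: hat_def compl_seq_def)
  then show ?thesis
    using cantor_real_N[OF assms] cantor_real_N[OF assms(1) hat_in_N[OF assms]]
    by (simp add: cantor_real_compl diff_divide_distrib[symmetric])
qed

lemma centre_0: "centre 0 = 1 / 2"
  by (simp add: centre_def)

lemma centre_pos:
  assumes "k \<ge> 1"
  shows "centre k = 5 / (2 * 3 ^ k)"
proof -
  have "(\<lambda>i. i = k - 1) \<in> N k" using assms by (simp add: N_iff)
  with assms show ?thesis by (simp add: centre_eq cantor_real_hat)
qed

lemma cantor_real_hat_centre:
  assumes "k \<ge> 1" "\<alpha> \<in> N k"
  shows "cantor_real (hat k \<alpha>) = 2 * centre k - cantor_real \<alpha>"
  using assms by (simp add: cantor_real_hat centre_pos)

text \<open>The numbers of \<open>N k\<close> lie in an interval of length \<open>1 / 3 ^ k\<close>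
  around \<open>centre k\<close>, so this disc contains every lower semicircle of
  \<open>H_part k\<close>.\<close>

definition disc :: "nat \<Rightarrow> (real \<times> real) set" where
  "disc k = cball (centre k, 0) (1 / (2 * 3 ^ k))"

text \<open>The origin is added as the point to which the discs shrink.\<close>

definition discs :: "(real \<times> real) set" where
  "discs = insert (0, 0) (\<Union>k\<in>{1..}. disc k)"

text \<open>The left intersection of the axis with the circle through \<open>p\<close> around the
  centre of its disc. The choice of \<open>k\<close> is harmless since the discs are disjoint, and 0
  is the limit value at the origin.\<close>

definition left_end :: "real \<times> real \<Rightarrow> real" where
  "left_end p = (if p = (0, 0) then 0
     else let k = (SOME k. k \<ge> 1 \<and> p \<in> disc k) in centre k - dist p (centre k, 0))"

section \<open>Separation of the discs and continuity of the left end\<close>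

lemma dist_fst_bound: "\<bar>fst p - c\<bar> \<le> dist p (c, 0 :: real)"
  using dist_fst_le[of p "(c, 0)"] by (simp add: dist_real_def)

lemma dist_axis: "dist (t, 0 :: real) (c, 0) = \<bar>t - c\<bar>"
  by (simp add: dist_Pair_Pair dist_real_def)

lemma disc_fst_bounds:
  assumes "k \<ge> 1" "p \<in> disc k"
  shows "2 / 3 ^ k \<le> fst p" "fst p \<le> 3 / 3 ^ k"
proof -
  have "\<bar>fst p - 5 / (2 * 3 ^ k)\<bar> \<le> 1 / (2 * 3 ^ k)"
    using assms dist_fst_bound[of p "centre k"] by (simp add: disc_def dist_commute centre_pos)
  then have "\<bar>fst p - 5 / 2 * (1 / 3 ^ k)\<bar> \<le> 1 / 2 * (1 / 3 ^ k)" by simp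
  then have "2 * (1 / 3 ^ k) \<le> fst p" "fst p \<le> 3 * (1 / 3 ^ k)"
    unfolding abs_le_iff by linarith+
  then show "2 / 3 ^ k \<le> fst p" "fst p \<le> 3 / 3 ^ k" by simp_all
qed

text \<open>A disc of larger index stays at \<open>x \<le> 1 / 3 ^ k\<close>, one of smaller index
  at \<open>x \<ge> 6 / 3 ^ k\<close>. The open strip between these bounds thus isolates disc
  \<open>k\<close>.\<close>

lemma disc_index_unique:
  assumes "j \<ge> 1" "p \<in> disc j" "1 / 3 ^ k < fst p" "fst p < 6 / 3 ^ k"
  shows "j = k"
proof (rule ccontr)
  assume "j \<noteq> k"
  then consider "Suc k \<le> j" | "Suc j \<le> k" by linarith
  then show False
  proof cases
    case 1
    then have "(3::real) / 3 ^ j \<le> 3 / 3 ^ Suc k"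
      by (intro divide_left_mono power_increasing) auto
    then show False using disc_fst_bounds[OF assms(1,2)] assms(3) by simp
  next
    case 2
    then have "(6::real) / 3 ^ k \<le> 6 / 3 ^ Suc j"
      by (intro divide_left_mono power_increasing) auto
    then show False using disc_fst_bounds[OF assms(1,2)] assms(4) by simp
  qed
qed

lemma disc_fst_strict_bounds:
  assumes "k \<ge> 1" "p \<in> disc k"
  shows "1 / 3 ^ k < fst p" "fst p < 6 / 3 ^ k"
proof -
  have "(1::real) / 3 ^ k < 2 / 3 ^ k" "(3::real) / 3 ^ k < 6 / 3 ^ k"
    by (intro divide_strict_right_mono; simp)+
  then show "1 / 3 ^ k < fst p" "fst p < 6 / 3 ^ k"
    using disc_fst_bounds[OF assms] by linarith+
qed

lemma left_end_disc:
  assumes "k \<ge> 1" "p \<in> disc k"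
  shows "left_end p = centre k - dist p (centre k, 0)"
proof -
  have "0 < (1::real) / 3 ^ k" by simp
  then have "p \<noteq> (0, 0)" using disc_fst_strict_bounds[OF assms] by auto
  moreover have "(SOME j. j \<ge> 1 \<and> p \<in> disc j) = k"
    using assms disc_index_unique disc_fst_strict_bounds by (intro some_equality) blast+
  ultimately show ?thesis by (simp add: left_end_def)
qed

lemma left_end_bounds:
  assumes "p \<in> discs"
  shows "0 \<le> left_end p" "left_end p \<le> fst p"
proof -
  have "0 \<le> left_end p \<and> left_end p \<le> fst p"
  proof (cases "p = (0, 0)")
    case True
    then show ?thesis by (simp add: left_end_def)
  next
    case False
    then obtain k where k: "k \<ge> 1" "p \<in> disc k"
      using assms by (auto simp: discs_def)
    have "dist p (centre k, 0) \<le> 1 / (2 * 3 ^ k)"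
      using k by (simp add: disc_def dist_commute)
    also have "\<dots> \<le> centre k"
      using k(1) by (simp add: centre_pos divide_right_mono)
    finally show ?thesis
      using k dist_fst_bound[of p "centre k"] by (simp add: left_end_disc)
  qed
  then show "0 \<le> left_end p" "left_end p \<le> fst p" by auto
qed

lemma continuous_on_left_end: "continuous_on discs left_end"
  unfolding continuous_on_eq_continuous_within
proof
  fix p assume p: "p \<in> discs"
  show "continuous (at p within discs) left_end"
  proof (cases "p = (0, 0)")
    case True
    \<comment> \<open>At the origin infinitely many discs accumulate; there the value is squeezed
      between 0 and the first coordinate.\<close>
    have "\<forall>\<^sub>F q in at p within discs. norm (left_end q) \<le> norm (fst q)"
      unfolding eventually_at_filter using left_end_bounds by (intro always_eventually) force
    moreover have "((\<lambda>q. fst q) \<longlongrightarrow> 0) (at p within discs)"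
      using tendsto_fst[OF tendsto_ident_at[of p discs]] True by simp
    ultimately have "(left_end \<longlongrightarrow> 0) (at p within discs)"
      by (rule Lim_null_comparison[OF _ tendsto_norm_zero])
    then show ?thesis using True by (simp add: continuous_within left_end_def)
  next
    case False
    then obtain k where k: "k \<ge> 1" "p \<in> disc k"
      using p by (auto simp: discs_def)
    \<comment> \<open>On this strip \<open>discs\<close> reduces to a single disc, so one distance
      formula holds near \<open>p\<close>.\<close>
    define U :: "(real \<times> real) set" where "U = {1 / 3 ^ k <..< 6 / 3 ^ k} \<times> UNIV"
    have U: "open U" "p \<in> U"
      using disc_fst_strict_bounds[OF k] by (auto simp: U_def open_Times mem_Times_iff)
    have eq: "left_end q = centre k - dist q (centre k, 0)" if q: "q \<in> discs" "q \<in> U" for q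
    proof -
      have "0 < (1::real) / 3 ^ k" by simp
      then have "q \<noteq> (0, 0)" using q(2) by (auto simp: U_def)
      then obtain j where j: "j \<ge> 1" "q \<in> disc j"
        using q(1) by (auto simp: discs_def)
      then have "j = k"
        using q(2) disc_index_unique[of j q k] by (auto simp: U_def mem_Times_iff)
      then show ?thesis using j left_end_disc by simp
    qed
    have "continuous (at p within discs) (\<lambda>q. centre k - dist q (centre k, 0))"
      by (intro continuous_intros)
    then show ?thesis
      unfolding continuous_within
      using Lim_transform_within_openin[of _ _ p discs "discs \<inter> U" left_end] U p eq
      by (simp add: openin_open_Int)
  qed
qed

text \<open>Passing to the left end of the lower arc either fixes the point or replaces
  \<open>\<alpha>\<close> by \<open>hat k \<alpha>\<close>; the zero sequence stays where it
  is.\<close>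

lemma left_end_cantor_real:
  shows "(cantor_real \<alpha>, 0) \<in> discs"
    and "\<exists>\<beta>. left_end (cantor_real \<alpha>, 0) = cantor_real \<beta> \<and> E0_star \<alpha> \<beta>"
proof -
  have "(cantor_real \<alpha>, 0) \<in> discs \<and>
    (\<exists>\<beta>. left_end (cantor_real \<alpha>, 0) = cantor_real \<beta> \<and> E0_star \<alpha> \<beta>)"
  proof (cases \<alpha> rule: N_cases)
    case 1
    then have "cantor_real \<alpha> = 0" by (simp add: cantor_real_def)
    then show ?thesis by (auto simp: discs_def left_end_def intro!: exI[of _ \<alpha>] E0_star_refl)
  next
    case (2 k)
    have "\<bar>cantor_real \<alpha> - 5 / 2 * (1 / 3 ^ k)\<bar> \<le> 1 / 2 * (1 / 3 ^ k)"
      using cantor_real_N_bounds[OF 2] by (simp add: abs_le_iff field_simps)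
    then have disc: "(cantor_real \<alpha>, 0) \<in> disc k"
      using 2 by (simp add: disc_def dist_commute dist_axis centre_pos)
    then have "left_end (cantor_real \<alpha>, 0) = centre k - \<bar>cantor_real \<alpha> - centre k\<bar>"
      using 2 by (simp add: left_end_disc dist_axis)
    then have "left_end (cantor_real \<alpha>, 0) \<in> {cantor_real \<alpha>, cantor_real (hat k \<alpha>)}"
      using cantor_real_hat_centre[OF 2] by (auto simp: abs_if)
    then show ?thesis
      using disc 2(1) E0_star_refl E0_star_hat by (auto simp: discs_def)
  qed
  then show "(cantor_real \<alpha>, 0) \<in> discs"
    "\<exists>\<beta>. left_end (cantor_real \<alpha>, 0) = cantor_real \<beta> \<and> E0_star \<alpha> \<beta>" by auto
qed

section \<open>Points of the continuum\<close>

lemma sphere_axis: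
  assumes "(x, 0 :: real) \<in> sphere (c, 0) \<bar>c - t\<bar>"
  shows "x = t \<or> x = 2 * c - t"
  using assms by (auto simp: dist_commute dist_axis abs_if split: if_splits)

text \<open>A semicircle meets the axis only in its two ends, and the end opposite to
  \<open>\<alpha>\<close> has digits \<open>compl_seq \<alpha>\<close> or
  \<open>hat k \<alpha>\<close>.\<close>

lemma knaster_axis:
  assumes "(x, 0) \<in> knaster"
  shows "x \<in> range cantor_real"
proof -
  obtain k where "(x, 0) \<in> H_part k"
    using assms by (auto simp: knaster_def)
  then have "\<exists>\<alpha>\<in>N k. (x, 0 :: real) \<in> sphere (centre k, 0) \<bar>centre k - cantor_real \<alpha>\<bar>"
    by (auto simp: H_part_def upper_semicircle_def lower_semicircle_def split: if_splits)
  then obtain \<alpha> where \<alpha>: "\<alpha> \<in> N k"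
      "(x, 0 :: real) \<in> sphere (centre k, 0) \<bar>centre k - cantor_real \<alpha>\<bar>"
    by blast
  have "2 * centre k - cantor_real \<alpha> \<in> range cantor_real"
  proof (cases "k = 0")
    case True
    then have "2 * centre k - cantor_real \<alpha> = cantor_real (compl_seq \<alpha>)"
      by (simp add: centre_0 cantor_real_compl)
    then show ?thesis by simp
  next
    case False
    then have "2 * centre k - cantor_real \<alpha> = cantor_real (hat k \<alpha>)"
      using cantor_real_hat_centre[of k \<alpha>] \<alpha>(1) by simp
    then show ?thesis by simp
  qed
  then show ?thesis using sphere_axis[OF \<alpha>(2)] by auto
qed

text \<open>Replacing \<open>\<alpha>\<close> by its complement if necessary makes it the left end
  of the arc, which removes the absolute value.\<close>

lemma knaster_upper:
  assumes "p \<in> knaster" "snd p \<ge> 0"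
  obtains \<alpha> where "dist p (1/2, 0) = 1/2 - cantor_real \<alpha>"
proof -
  have "\<exists>\<alpha>. dist p (1/2, 0) = \<bar>1/2 - cantor_real \<alpha>\<bar>"
  \<comment> \<open>A point on the axis may have been supplied by a lower semicircle; it is
    nevertheless an end of an upper one.\<close>
  proof (cases "snd p = 0")
    case True
    then obtain \<alpha> where "p = (cantor_real \<alpha>, 0)"
      using assms knaster_axis[of "fst p"] by (cases p) auto
    then show ?thesis by (metis dist_axis abs_minus_commute)
  next
    case False
    then show ?thesis
      using assms by (auto simp: knaster_def H_part_def upper_semicircle_def
          lower_semicircle_def centre_0 dist_commute split: if_splits)
  qed
  then obtain \<alpha> where \<alpha>: "dist p (1/2, 0) = \<bar>1/2 - cantor_real \<alpha>\<bar>" by blast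
  show ?thesis
  proof (cases "cantor_real \<alpha> \<le> 1/2")
    case True
    then show ?thesis using \<alpha> that by simp
  next
    case False
    then show ?thesis using \<alpha> that[of "compl_seq \<alpha>"] by (simp add: cantor_real_compl)
  qed
qed

text \<open>Here \<open>hat k\<close> interchanges the two ends, so \<open>\<alpha>\<close> can
  again be taken as the left one.\<close>

lemma knaster_lower:
  assumes "p \<in> knaster" "snd p \<le> 0"
  obtains "p = (0, 0)"
    | k \<alpha> where "k \<ge> 1" "\<alpha> \<in> N k" "dist p (centre k, 0) = centre k - cantor_real \<alpha>"
proof -
  have "p = (0, 0) \<or> (\<exists>k\<ge>1. \<exists>\<alpha>\<in>N k. dist p (centre k, 0) = \<bar>centre k - cantor_real \<alpha>\<bar>)"
  proof (cases "snd p = 0")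
    case True
    then obtain \<alpha> where \<alpha>: "p = (cantor_real \<alpha>, 0)"
      using assms knaster_axis[of "fst p"] by (cases p) auto
    show ?thesis
    proof (cases \<alpha> rule: N_cases)
      case 1
      then show ?thesis using \<alpha> by (simp add: cantor_real_def)
    next
      case (2 k)
      then show ?thesis using \<alpha> by (metis dist_axis abs_minus_commute)
    qed
  next
    case False
    then show ?thesis
      using assms by (fastforce simp: knaster_def H_part_def upper_semicircle_def
          lower_semicircle_def dist_commute split: if_splits)
  qed
  then consider "p = (0, 0)"
    | k \<alpha> where "k \<ge> 1" "\<alpha> \<in> N k" "dist p (centre k, 0) = \<bar>centre k - cantor_real \<alpha>\<bar>"
    by blast
  then show ?thesis
  proof cases
    case 1
    then show ?thesis by (rule that(1))
  next
    case (2 k \<alpha>)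
    show ?thesis
    proof (cases "cantor_real \<alpha> \<le> centre k")
      case True
      then show ?thesis using 2 that(2) by simp
    next
      case False
      then show ?thesis
        using 2 that(2)[OF 2(1) hat_in_N[OF 2(1,2)]] by (simp add: cantor_real_hat_centre)
    qed
  qed
qed

lemma left_end_lower_arc:
  assumes "k \<ge> 1" "\<alpha> \<in> N k" "dist p (centre k, 0) = centre k - cantor_real \<alpha>"
  shows "p \<in> disc k" "left_end p = cantor_real \<alpha>"
proof -
  have "centre k - cantor_real \<alpha> \<le> 5 / 2 * (1 / 3 ^ k) - 2 * (1 / 3 ^ k)"
    using cantor_real_N_bounds(1)[OF assms(1,2)] centre_pos[OF assms(1)] by simp
  also have "\<dots> = 1 / (2 * 3 ^ k)" by simp
  finally show disc: "p \<in> disc k"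
    using assms(3) by (simp add: disc_def dist_commute)
  show "left_end p = cantor_real \<alpha>"
    using assms disc by (simp add: left_end_disc)
qed

lemma knaster_lower_in_discs:
  assumes "p \<in> knaster" "snd p \<le> 0"
  shows "p \<in> discs" "left_end p \<in> range cantor_real"
proof -
  have "p \<in> discs \<and> left_end p \<in> range cantor_real"
    using assms
  proof (cases rule: knaster_lower)
    case 1
    have "cantor_real (\<lambda>_. False) = 0" by (simp add: cantor_real_def)
    then show ?thesis using 1 by (metis discs_def insertI1 left_end_def rangeI)
  next
    case (2 k \<alpha>)
    then show ?thesis using left_end_lower_arc[OF 2] by (auto simp: discs_def)
  qed
  then show "p \<in> discs" "left_end p \<in> range cantor_real" by auto
qed

section \<open>Semicircles are paths\<close>

text \<open>The arc is the graph of a continuous function over an interval; for negative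
  \<open>r\<close> it is empty.\<close>

lemma path_connected_upper_semicircle: "path_connected (upper_semicircle c r)"
proof (cases "r \<ge> 0")
  case True
  have "upper_semicircle c r = (\<lambda>t. (c + t, sqrt (r\<^sup>2 - t\<^sup>2))) ` {-r..r}" (is "_ = ?f ` _")
  proof
    show "upper_semicircle c r \<subseteq> ?f ` {-r..r}"
    proof
      fix p assume "p \<in> upper_semicircle c r"
      then obtain x y where p: "p = (x, y)" "y \<ge> 0" "r\<^sup>2 = (x - c)\<^sup>2 + y\<^sup>2"
        by (cases p) (auto simp: upper_semicircle_def dist_Pair_Pair dist_real_def power2_commute)
      have "\<bar>x - c\<bar> \<le> r"
        using p(3) True
        by (metis abs_le_square_iff abs_of_nonneg le_add_same_cancel1 zero_le_power2)
      moreover have "p = ?f (x - c)" using p by simp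
      ultimately show "p \<in> ?f ` {-r..r}" by (intro image_eqI) auto
    qed
    show "?f ` {-r..r} \<subseteq> upper_semicircle c r"
    proof clarify
      fix t assume "t \<in> {-r..r}"
      then have "t\<^sup>2 \<le> r\<^sup>2" by (intro abs_le_square_iff[THEN iffD1]) auto
      then show "?f t \<in> upper_semicircle c r"
        using True by (simp add: upper_semicircle_def dist_Pair_Pair dist_real_def)
    qed
  qed
  moreover have "path_connected (?f ` {-r..r})"
    by (intro path_connected_continuous_image continuous_intros convex_imp_path_connected) simp
  ultimately show ?thesis by simp
qed (simp add: upper_semicircle_def)

lemma path_connected_lower_semicircle: "path_connected (lower_semicircle c r)"
proof -
  have "lower_semicircle c r = (\<lambda>p. (fst p, - snd p)) ` upper_semicircle c r"
    by (auto simp: upper_semicircle_def lower_semicircle_def dist_Pair_Pair dist_real_def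
        intro!: image_eqI[of _ _ "(a, - b)" for a b])
  moreover have "path_connected \<dots>"
    by (intro path_connected_continuous_image continuous_intros path_connected_upper_semicircle)
  ultimately show ?thesis by simp
qed

lemma path_component_upper:
  assumes "dist p (1/2, 0) = \<bar>1/2 - cantor_real \<alpha>\<bar>" "snd p \<ge> 0"
    and "dist q (1/2, 0) = \<bar>1/2 - cantor_real \<alpha>\<bar>" "snd q \<ge> 0"
  shows "path_component knaster p q"
proof -
  let ?S = "upper_semicircle (centre 0) \<bar>centre 0 - cantor_real \<alpha>\<bar>"
  have "p \<in> ?S" "q \<in> ?S"
    using assms by (auto simp: upper_semicircle_def dist_commute centre_0)
  then have "path_component ?S p q"
    using path_connected_upper_semicircle by (auto simp: path_connected_component)
  moreover have "?S \<subseteq> knaster"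
    unfolding knaster_def H_part_def by (force simp: N_def)
  ultimately show ?thesis by (rule path_component_of_subset[rotated])
qed

lemma path_component_lower:
  assumes "k \<ge> 1" "\<alpha> \<in> N k"
    and "dist p (centre k, 0) = \<bar>centre k - cantor_real \<alpha>\<bar>" "snd p \<le> 0"
    and "dist q (centre k, 0) = \<bar>centre k - cantor_real \<alpha>\<bar>" "snd q \<le> 0"
  shows "path_component knaster p q"
proof -
  let ?S = "lower_semicircle (centre k) \<bar>centre k - cantor_real \<alpha>\<bar>"
  have "p \<in> ?S" "q \<in> ?S"
    using assms by (auto simp: lower_semicircle_def dist_commute)
  then have "path_component ?S p q"
    using path_connected_lower_semicircle by (auto simp: path_connected_component)
  moreover have "?S \<subseteq> H_part k"
    using assms(1,2) by (auto simp: H_part_def)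
  then have "?S \<subseteq> knaster"
    unfolding knaster_def by blast
  ultimately show ?thesis by (rule path_component_of_subset[rotated])
qed

text \<open>By \<open>E0_star_least\<close> only the generating moves matter: complementing follows
  an upper arc, and \<open>hat k\<close> a lower one.\<close>

lemma E0_star_imp_path_component:
  assumes "E0_star \<alpha> \<beta>"
  shows "path_component knaster (cantor_real \<alpha>, 0) (cantor_real \<beta>, 0)"
  using assms
proof (rule E0_star_least[rotated -1])
  fix \<alpha>
  show "path_component knaster (cantor_real \<alpha>, 0) (cantor_real \<alpha>, 0)"
    by (rule path_component_upper[of _ \<alpha>]) (auto simp: dist_axis)
  show "path_component knaster (cantor_real \<alpha>, 0) (cantor_real (compl_seq \<alpha>), 0)"
    by (rule path_component_upper[of _ \<alpha>]) (auto simp: dist_axis cantor_real_compl)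
next
  fix k \<alpha> assume "k \<ge> 1" "\<alpha> \<in> N k"
  then show "path_component knaster (cantor_real \<alpha>, 0) (cantor_real (hat k \<alpha>), 0)"
    by (intro path_component_lower[of k \<alpha>]) (auto simp: dist_axis cantor_real_hat_centre)
qed (auto intro: path_component_sym path_component_trans)

section \<open>The reductions\<close>

text \<open>Digits of the left end of an arc through \<open>p\<close>. The value may jump across the
  axis, but only within a class of \<open>E0_star\<close>; this is the reduction from the
  continuum.\<close>

definition arc_label :: "real \<times> real \<Rightarrow> cantor" where
  "arc_label p = cantor_digits (if snd p \<ge> 0 then 1/2 - dist p (1/2, 0) else left_end p)"

text \<open>Slides a point along its circle around \<open>(1/2, 0)\<close> to the axis, keeping its
  side of \<open>x = 1/2\<close>.\<close>

definition foot :: "real \<times> real \<Rightarrow> real" where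
  "foot p = (if fst p \<le> 1/2 then 1/2 - dist p (1/2, 0) else 1/2 + dist p (1/2, 0))"

text \<open>A substitute for \<open>arc_label\<close> that crosses the axis continuously; the price
  is a possible jump at \<open>x = 1/2\<close>.\<close>

definition lower_label :: "real \<times> real \<Rightarrow> cantor" where
  "lower_label p = cantor_digits (if snd p \<le> 0 then left_end p else left_end (foot p, 0))"

lemma path_component_arc_label:
  assumes "p \<in> knaster"
  shows "path_component knaster p (cantor_real (arc_label p), 0)"
proof (cases "snd p \<ge> 0")
  case True
  obtain \<alpha> where \<alpha>: "dist p (1/2, 0) = 1/2 - cantor_real \<alpha>"
    using knaster_upper[OF assms True] .
  then have "arc_label p = \<alpha>" using True by (simp add: arc_label_def)
  moreover have "cantor_real \<alpha> \<le> 1/2"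
    using \<alpha> zero_le_dist[of p "(1/2, 0)"] by linarith
  ultimately show ?thesis
    using \<alpha> True by (intro path_component_upper[of _ \<alpha>]) (auto simp: dist_axis)
next
  case False
  then have "snd p \<le> 0" by simp
  with assms show ?thesis
  proof (cases rule: knaster_lower)
    case 1
    then show ?thesis using False by simp
  next
    case (2 k \<alpha>)
    then have "arc_label p = \<alpha>"
      using False left_end_lower_arc[OF 2] by (simp add: arc_label_def)
    moreover have "cantor_real \<alpha> \<le> centre k"
      using 2(3) zero_le_dist[of p "(centre k, 0)"] by linarith
    ultimately show ?thesis
      using 2 False by (intro path_component_lower[of k \<alpha>]) (auto simp: dist_axis)
  qed
qed

lemma foot_upper:
  assumes "p \<in> knaster" "snd p \<ge> 0"
  obtains \<beta> where "foot p = cantor_real \<beta>" "E0_star (arc_label p) \<beta>"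
proof -
  obtain \<alpha> where \<alpha>: "dist p (1/2, 0) = 1/2 - cantor_real \<alpha>"
    using knaster_upper[OF assms] .
  then have "arc_label p = \<alpha>" using assms by (simp add: arc_label_def)
  moreover have "foot p = cantor_real \<alpha> \<or> foot p = cantor_real (compl_seq \<alpha>)"
    using \<alpha> by (simp add: foot_def cantor_real_compl)
  ultimately show ?thesis using that E0_star_refl E0_star_compl_seq by metis
qed

lemma foot_axis: "foot (x, 0) = x"
  by (simp add: foot_def dist_axis)

text \<open>The two labels differ at most by changing the end of an upper arc and then of a lower
  arc, so either one determines the class.\<close>

lemma arc_label_lower_label:
  assumes "p \<in> knaster"
  shows "E0_star (arc_label p) (lower_label p)"
proof (cases "snd p \<ge> 0")
  case True
  obtain \<beta> where \<beta>: "foot p = cantor_real \<beta>" "E0_star (arc_label p) \<beta>"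
    using foot_upper[OF assms True] .
  have "lower_label p = cantor_digits (left_end (foot p, 0))"
    using True foot_axis[of "fst p"] by (cases p) (auto simp: lower_label_def)
  then show ?thesis
    using \<beta> left_end_cantor_real(2)[of \<beta>] E0_star_trans by auto
qed (simp add: arc_label_def lower_label_def E0_star_refl)

section \<open>Continuity of the two labels\<close>

lemma continuous_on_foot: "continuous_on {p. fst p \<noteq> 1/2} foot"
proof -
  have "{p :: real \<times> real. fst p \<noteq> 1/2} = {p. fst p < 1/2} \<union> {p. fst p > 1/2}" by auto
  moreover have "continuous_on ({p. fst p < 1/2} \<union> {p. fst p > 1/2}) foot"
  proof (rule continuous_on_open_Un)
    show "open {p :: real \<times> real. fst p < 1/2}" "open {p :: real \<times> real. fst p > 1/2}"
      by (intro open_Collect_less continuous_intros)+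
    have "continuous_on {p. fst p < 1/2} (\<lambda>p. 1/2 - dist p (1/2, 0 :: real))"
      by (intro continuous_intros)
    then show "continuous_on {p. fst p < 1/2} foot"
      by (rule continuous_on_eq) (auto simp: foot_def)
    have "continuous_on {p. fst p > 1/2} (\<lambda>p. 1/2 + dist p (1/2, 0 :: real))"
      by (intro continuous_intros)
    then show "continuous_on {p. fst p > 1/2} foot"
      by (rule continuous_on_eq) (auto simp: foot_def)
  qed
  ultimately show ?thesis by simp
qed

text \<open>The pieces \<open>y \<le> 0\<close> and \<open>y \<ge> 0\<close> are glued along the
  axis, where they agree because \<open>foot\<close> fixes axis points.\<close>

lemma continuous_on_lower_label: "continuous_on (knaster \<inter> {p. fst p \<noteq> 1/2}) lower_label"
proof -
  let ?V = "knaster \<inter> {p. fst p \<noteq> 1/2}"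
  let ?h = "\<lambda>p. if snd p \<le> 0 then left_end p else left_end (foot p, 0)"
  have "continuous_on ?V ?h"
  proof (rule continuous_on_cases_le)
    show "continuous_on {p \<in> ?V. snd p \<le> 0} left_end"
      by (rule continuous_on_subset[OF continuous_on_left_end]) (auto intro: knaster_lower_in_discs)
    have "continuous_on {p \<in> ?V. 0 \<le> snd p} (\<lambda>p. (foot p, 0 :: real))"
      by (intro continuous_intros continuous_on_subset[OF continuous_on_foot]) auto
    moreover have "(foot p, 0) \<in> discs" if "p \<in> ?V" "0 \<le> snd p" for p
      using that foot_upper[of p] left_end_cantor_real(1) by (metis IntD1)
    ultimately show "continuous_on {p \<in> ?V. 0 \<le> snd p} (\<lambda>p. left_end (foot p, 0))"
      by (intro continuous_on_compose2[OF continuous_on_left_end]) auto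
    show "left_end p = left_end (foot p, 0)" if "p \<in> ?V" "snd p = 0" for p
      using that foot_axis[of "fst p"] by (cases p) simp
  qed (intro continuous_intros)
  moreover have "?h p \<in> range cantor_real" if p: "p \<in> ?V" for p
  proof (cases "snd p \<le> 0")
    case True
    then show ?thesis using p knaster_lower_in_discs(2) by auto
  next
    case False
    then obtain \<beta> where "foot p = cantor_real \<beta>"
      using p foot_upper[of p] by auto
    then show ?thesis using False left_end_cantor_real(2)[of \<beta>] by auto
  qed
  then have "?h ` ?V \<subseteq> range cantor_real" by blast
  ultimately show ?thesis
    unfolding lower_label_def by (rule continuous_on_compose2[OF continuous_on_cantor_digits])
qed

lemma continuous_on_arc_label_upper: "continuous_on (knaster \<inter> {p. snd p \<ge> 0}) arc_label"
proof -
  have "1/2 - dist p (1/2, 0) \<in> range cantor_real" if "p \<in> knaster" "snd p \<ge> 0" for p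
    using knaster_upper[OF that] by (metis diff_diff_eq2 add_diff_cancel_left' rangeI)
  then have "continuous_on (knaster \<inter> {p. snd p \<ge> 0}) (\<lambda>p. cantor_digits (1/2 - dist p (1/2, 0)))"
    by (intro continuous_on_compose2[OF continuous_on_cantor_digits] continuous_intros) auto
  then show ?thesis by (rule continuous_on_eq) (auto simp: arc_label_def)
qed

lemma continuous_on_arc_label_lower: "continuous_on (knaster \<inter> {p. snd p < 0}) arc_label"
proof -
  have "continuous_on (knaster \<inter> {p. snd p < 0}) (\<lambda>p. cantor_digits (left_end p))"
    by (intro continuous_on_compose2[OF continuous_on_cantor_digits]
        continuous_on_subset[OF continuous_on_left_end])
      (auto intro: knaster_lower_in_discs)
  then show ?thesis by (rule continuous_on_eq) (auto simp: arc_label_def)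
qed

text \<open>Near each parameter one of the two labels is constant along the path, so the class is
  locally constant on the connected interval.\<close>

lemma path_component_imp_E0_star:
  assumes "path_component knaster p q"
  shows "E0_star (arc_label p) (arc_label q)"
proof -
  obtain \<gamma> where \<gamma>: "continuous_on {0..1::real} \<gamma>" "\<gamma> ` {0..1} \<subseteq> knaster" "\<gamma> 0 = p" "\<gamma> 1 = q"
    using assms by (auto simp: path_component_def path_def path_image_def pathstart_def pathfinish_def)
  have label_const: "\<exists>T. openin (top_of_set {0..1}) T \<and> s \<in> T \<and> (\<forall>t\<in>T. g (\<gamma> s) = g (\<gamma> t))"
    if W: "open W" "continuous_on (knaster \<inter> W) g" "s \<in> {0..1}" "\<gamma> s \<in> W"
    for W s and g :: "real \<times> real \<Rightarrow> cantor"
  proof -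
    have "openin (top_of_set {0..1}) ({0..1} \<inter> \<gamma> -` W)"
      using \<gamma>(1) W(1) by (rule continuous_openin_preimage_gen)
    then obtain e where e: "e > 0" "ball s e \<inter> {0..1} \<subseteq> {0..1} \<inter> \<gamma> -` W"
      using W(3,4) unfolding openin_contains_ball by (metis IntI vimageI2)
    \<comment> \<open>The preimage of \<open>W\<close> need not be connected; an interval inside it
      is.\<close>
    let ?T = "ball s e \<inter> {0..1}"
    have "continuous_on ?T (\<lambda>t. g (\<gamma> t))"
      using e \<gamma>(1,2)
      by (intro continuous_on_compose2[OF W(2)] continuous_on_subset[OF \<gamma>(1)]) auto
    moreover have "connected ?T"
      by (intro convex_connected convex_Int) auto
    ultimately have "\<forall>t\<in>?T. g (\<gamma> s) = g (\<gamma> t)"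
      using connected_imp_constant_cantor[of ?T "\<lambda>t. g (\<gamma> t)" s] W(3) e(1) by auto
    moreover have "openin (top_of_set {0..1}) ?T"
      using openin_open_Int[OF open_ball, of "{0..1}" s e] by (simp add: Int_commute)
    ultimately show ?thesis using W(3) e(1) by (intro exI[of _ ?T]) auto
  qed
  have "E0_star (arc_label (\<gamma> 0)) (arc_label (\<gamma> 1))"
  proof (rule connected_equivalence_relation[where S = "{0..1}"
        and R = "\<lambda>s t. E0_star (arc_label (\<gamma> s)) (arc_label (\<gamma> t))"])
    fix s :: real assume s: "s \<in> {0..1}"
    show "\<exists>T. openin (top_of_set {0..1}) T \<and> s \<in> T \<and>
        (\<forall>t\<in>T. E0_star (arc_label (\<gamma> s)) (arc_label (\<gamma> t)))"
    proof (cases "fst (\<gamma> s) = 1/2")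
      case True
      \<comment> \<open>Disc 1 lies at \<open>x \<ge> 2/3\<close> and all later discs at
        \<open>x \<le> 1/3\<close>, so the line \<open>x = 1/2\<close> meets the continuum only
        above the axis.\<close>
      have "snd (\<gamma> s) > 0"
      proof (rule ccontr)
        assume "\<not> snd (\<gamma> s) > 0"
        then have "snd (\<gamma> s) \<le> 0" "\<gamma> s \<in> knaster" using s \<gamma>(2) by auto
        then have "\<gamma> s \<in> discs" by (intro knaster_lower_in_discs)
        then obtain k where k: "k \<ge> 1" "\<gamma> s \<in> disc k"
          using True by (auto simp: discs_def)
        have "k \<noteq> 1" using disc_fst_bounds(1)[OF k] True by auto
        then have "2 \<le> k" using k by simp
        then have "(3::real) / 3 ^ k \<le> 3 / 3 ^ 2"
          by (intro divide_left_mono power_increasing) auto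
        then show False using disc_fst_bounds(2)[OF k] True by simp
      qed
      moreover have "open {p :: real \<times> real. snd p > 0}"
        by (intro open_Collect_less continuous_intros)
      moreover have "continuous_on (knaster \<inter> {p. snd p > 0}) arc_label"
        by (rule continuous_on_subset[OF continuous_on_arc_label_upper]) auto
      ultimately show ?thesis
        using label_const[of "{p. snd p > 0}" arc_label s] s E0_star_refl by (metis mem_Collect_eq)
    next
      case False
      have "open {p :: real \<times> real. fst p \<noteq> 1/2}"
        by (intro open_Collect_neq continuous_intros)
      then obtain T where T: "openin (top_of_set {0..1}) T" "s \<in> T"
          "\<forall>t\<in>T. lower_label (\<gamma> s) = lower_label (\<gamma> t)"
        using label_const[OF _ continuous_on_lower_label s] False by auto
      have "T \<subseteq> {0..1}" using T(1) by (rule openin_imp_subset)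
      then have "E0_star (arc_label (\<gamma> t)) (lower_label (\<gamma> t))" if "t \<in> T" for t
        using that \<gamma>(2) by (intro arc_label_lower_label) auto
      then show ?thesis using T E0_star_sym E0_star_trans by metis
    qed
  qed (auto intro: E0_star_sym E0_star_trans)
  then show ?thesis using \<gamma>(3,4) by simp
qed

lemma arc_label_cantor_real: "E0_star \<alpha> (arc_label (cantor_real \<alpha>, 0))"
proof -
  have "1/2 - dist (cantor_real \<alpha>, 0) (1/2, 0 :: real)
      \<in> {cantor_real \<alpha>, cantor_real (compl_seq \<alpha>)}"
    by (auto simp: dist_axis cantor_real_compl abs_if)
  then have "arc_label (cantor_real \<alpha>, 0) \<in> {\<alpha>, compl_seq \<alpha>}"
    by (auto simp: arc_label_def)
  then show ?thesis using E0_star_refl E0_star_compl_seq by auto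
qed

text \<open>Jumps along the axis do no harm: the label is continuous on each of two Borel
  pieces.\<close>

lemma measurable_arc_label: "arc_label \<in> restrict_space borel knaster \<rightarrow>\<^sub>M borel"
proof (rule measurable_piecewise_restrict[where C = "{{p. snd p \<ge> 0}, {p. snd p < 0}}"])
  have "{p :: real \<times> real. snd p \<ge> 0} \<in> sets borel"
    by (intro borel_closed closed_Collect_le continuous_intros)
  moreover have "{p :: real \<times> real. snd p < 0} \<in> sets borel"
    by (intro borel_open open_Collect_less continuous_intros)
  ultimately show "\<Omega> \<inter> space (restrict_space borel knaster) \<in> sets (restrict_space borel knaster)"
    if "\<Omega> \<in> {{p. snd p \<ge> 0}, {p. snd p < 0}}" for \<Omega>
    using that by (auto simp: sets_restrict_space space_restrict_space Int_commute)
  show "arc_label \<in> restrict_space (restrict_space borel knaster) \<Omega> \<rightarrow>\<^sub>M borel"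
    if "\<Omega> \<in> {{p. snd p \<ge> 0}, {p. snd p < 0}}" for \<Omega>
  proof -
    have "continuous_on (knaster \<inter> \<Omega>) arc_label"
      using that continuous_on_arc_label_upper continuous_on_arc_label_lower by auto
    then have "arc_label \<in> restrict_space borel (knaster \<inter> \<Omega>) \<rightarrow>\<^sub>M borel"
      by (rule borel_measurable_continuous_on_restrict)
    then show ?thesis
      using measurable_cong_sets[OF sets_restrict_restrict_space refl] by blast
  qed
qed auto

theorem theorem3p1:
  shows "borel_bireducible knaster (path_component knaster) UNIV E0_star"
  unfolding borel_bireducible_def borel_reducible_def
\<comment> \<open>The reducing maps are left open here; the first goal of each half fixes them as
  \<open>arc_label\<close> and the embedding of the Cantor set into the axis.\<close>
proof (intro conjI bexI ballI)
  fix p q assume "p \<in> knaster" "q \<in> knaster"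
  then show "path_component knaster p q \<longleftrightarrow> E0_star (arc_label p) (arc_label q)"
    by (meson E0_star_imp_path_component path_component_arc_label path_component_imp_E0_star
        path_component_sym path_component_trans)
next
  show "arc_label \<in> restrict_space borel knaster \<rightarrow>\<^sub>M restrict_space borel UNIV"
    using measurable_arc_label by (simp add: measurable_restrict_space2)
next
  fix \<alpha> \<beta> :: cantor
  show "E0_star \<alpha> \<beta> \<longleftrightarrow> path_component knaster (cantor_real \<alpha>, 0) (cantor_real \<beta>, 0)"
    by (meson E0_star_imp_path_component E0_star_sym E0_star_trans arc_label_cantor_real
        path_component_imp_E0_star)
next
  \<comment> \<open>Points related by \<open>path_component\<close> lie in the set, so the trivial
    relation of \<open>\<alpha>\<close> to itself gives membership.\<close>
  have "(cantor_real \<alpha>, 0) \<in> knaster" for \<alpha>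
    using E0_star_imp_path_component[OF E0_star_refl] by (rule path_component_mem(1))
  moreover have "(\<lambda>\<alpha>. (cantor_real \<alpha>, 0 :: real)) \<in> borel_measurable borel"
    by (intro borel_measurable_continuous_onI continuous_intros continuous_on_cantor_real)
  ultimately show "(\<lambda>\<alpha>. (cantor_real \<alpha>, 0))
      \<in> restrict_space borel UNIV \<rightarrow>\<^sub>M restrict_space borel knaster"
    by (intro measurable_restrict_space1 measurable_restrict_space2) auto
qed

end
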